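(* Let $r\ge1$ and $\mathbb A=\{1,\dots,r\}$. Let $\phi_{SF}:\mathbb Z[q,q^{-1}]\langle\langle\mathcal B\rangle\rangle\to\mathbb Z[t,t^{-1},q,q^{-1}]\langle\langle\mathcal B\rangle\rangle$ be the linear map defined on biwords by $\phi_{SF}(\alpha)=t^{\mathrm{exc}\,\alpha}q^{\mathrm{inv}^-\alpha}\alpha$. Then: (i) $\phi_{SF}([E]_{SF})=[\phi_{SF}(E)]_{SF_q}$ for every $E\in\mathbb Z[q,q^{-1}]\langle\langle\mathcal B\rangle\rangle$; (ii) $\phi_{SF}(EF)=\phi_{SF}(E)\,\phi_{SF}(F)$ whenever $E$ and $F$ are circular expressions.
   Context: A biword on $\mathbb A$ is a $2\times n$ matrix $\binom{x_1\cdots x_n}{a_1\cdots a_n}$ ($n\ge 0$) with entries in $\mathbb A$; the first row is its top word and the second row its bottom word. Biwords are viewed as words in biletters $\binom{x_i}{a_i}$ and multiplied by concatenation. $\mathcal B$ is the set of biwords, and $R\langle\langle\mathcal B\rangle\rangle$ is the algebra of formal sums $\sum_\alpha c(\alpha)\alpha$ with $c(\alpha)\in R$. For a word $w$, $\mathrm{inv}\,w$ is the number of pairs $i<j$ with $w_i>w_j$. For $\alpha=\binom{u}{v}$: - $\mathrm{inv}^-\alpha=\mathrm{inv}\,v-\mathrm{inv}\,u$; - $\mathrm{exc}\,\alpha=\#\{i:a_i>x_i\}$. A circuit is a biword whose top word is a rearrangement of its bottom word. A circular expression is one in which only circuits have nonzero coefficients. A reduction system is a set of pairs $(\alpha,E_\alpha)$,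 where $\alpha$ is a biword (the first components are distinct) and $E_\alpha$ is a finite linear combination of biwords. We use two of them: - $SF$ consists of $(\binom{xy}{ab},\binom{yx}{ba})$ for all $x>y$ and all $a,b\in\mathbb A$, with coefficients in $\mathbb Z[q,q^{-1}]$. - $SF_q$ consists, for all $x>y$, of $(\binom{xy}{ab},\binom{yx}{ba})$ if $a>b$, $(\binom{xy}{ab},q\binom{yx}{ba})$ if $a=b$, and $(\binom{xy}{ab},q^2\binom{yx}{ba})$ if $a<b$, with coefficients in $\mathbb Z[t^{\pm1},q^{\pm1}]$. For a reduction system $S$, a biword is irreducible if none of its factors of consecutive biletters is a first component. The leftmost reduction $[\ \cdot\ ]_S$ is the linear map (applied termwise) defined as follows: - $[\beta]_S=\beta$ for irreducible $\beta$; - otherwise write uniquely $\beta=\beta_1\beta_2\binom{x}{a}\beta_3$ with $\beta_1\beta_2$ irreducible and $\beta_2\binom{x}{a}=\alpha$ a first component, and set $[\beta]_S=[\beta_1E_\alpha\beta_3]_S$. *)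

theory Defs
  imports "HOL-Library.Poly_Mapping" "HOL-Library.Product_Plus" "HOL-Library.Multiset"
begin

section \<open>Biwords and their statistics\<close>

text \<open>The biletter with top entry \<open>x\<close> and bottom entry \<open>a\<close> is the pair \<open>(x, a)\<close>.\<close>

type_synonym biword = "(nat \<times> nat) list"

definition biwords :: "nat \<Rightarrow> biword set" where
  "biwords r = lists ({1..r} \<times> {1..r})"

definition top_word :: "biword \<Rightarrow> nat list" where
  "top_word \<alpha> = map fst \<alpha>"

definition bottom_word :: "biword \<Rightarrow> nat list" where
  "bottom_word \<alpha> = map snd \<alpha>"

definition inv_word :: "nat list \<Rightarrow> nat" where
  "inv_word w = card {(i, j). i < j \<and> j < length w \<and> w ! i > w ! j}"

definition inv_minus :: "biword \<Rightarrow> int" where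
  "inv_minus \<alpha> = int (inv_word (bottom_word \<alpha>)) - int (inv_word (top_word \<alpha>))"

definition exc :: "biword \<Rightarrow> nat" where
  "exc \<alpha> = card {i. i < length \<alpha> \<and> bottom_word \<alpha> ! i > top_word \<alpha> ! i}"

definition circuit :: "biword \<Rightarrow> bool" where
  "circuit \<alpha> \<longleftrightarrow> mset (top_word \<alpha>) = mset (bottom_word \<alpha>)"


section \<open>Laurent polynomials\<close>

text \<open>
  The Laurent polynomial rings are the monoid algebras of the exponent groups \<open>\<int>\<close> and
  \<open>\<int> \<times> \<int>\<close>, so that multiplication is convolution. In \<open>laurent_tq\<close> the pair \<open>(i, j)\<close> is the
  exponent of \<open>t\<^sup>i q\<^sup>j\<close>.
\<close>

type_synonym laurent_q = "int \<Rightarrow>\<^sub>0 int"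
type_synonym laurent_tq = "(int \<times> int) \<Rightarrow>\<^sub>0 int"

definition tq_monom :: "int \<Rightarrow> int \<Rightarrow> laurent_tq" where
  "tq_monom i j = Poly_Mapping.single (i, j) 1"

text \<open>The inclusion of \<open>\<int>[q, q\<^sup>-\<^sup>1]\<close> into \<open>\<int>[t, t\<^sup>-\<^sup>1, q, q\<^sup>-\<^sup>1]\<close>.\<close>

definition laurent_incl :: "laurent_q \<Rightarrow> laurent_tq" where
  "laurent_incl p =
     (\<Sum>j\<in>Poly_Mapping.keys p. Poly_Mapping.single (0, j) (Poly_Mapping.lookup p j))"


section \<open>Formal sums of biwords\<close>

text \<open>
  A formal sum is its coefficient function; infinite support is allowed, but only biwords over
  \<open>{1, \<dots>, r}\<close> may have a nonzero coefficient.
\<close>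

type_synonym 'c formal_sum = "biword \<Rightarrow> 'c"

definition formal_sums :: "nat \<Rightarrow> ('c::comm_ring_1) formal_sum set" where
  "formal_sums r = {E. \<forall>\<alpha>. E \<alpha> \<noteq> 0 \<longrightarrow> \<alpha> \<in> biwords r}"

definition fs_mult :: "('c::comm_ring_1) formal_sum \<Rightarrow> 'c formal_sum \<Rightarrow> 'c formal_sum" where
  "fs_mult E F = (\<lambda>\<alpha>. \<Sum>(\<beta>, \<gamma>) \<in> {(\<beta>, \<gamma>). \<beta> @ \<gamma> = \<alpha>}. E \<beta> * F \<gamma>)"

definition circular :: "('c::comm_ring_1) formal_sum \<Rightarrow> bool" where
  "circular E \<longleftrightarrow> (\<forall>\<alpha>. E \<alpha> \<noteq> 0 \<longrightarrow> circuit \<alpha>)"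


section \<open>Reduction systems and leftmost reduction\<close>

text \<open>The second components are finitely supported by their type.\<close>

type_synonym 'c red_system = "(biword \<times> (biword \<Rightarrow>\<^sub>0 'c)) set"

definition reduction_system :: "nat \<Rightarrow> ('c::comm_ring_1) red_system \<Rightarrow> bool" where
  "reduction_system r S \<longleftrightarrow>
     (\<forall>(\<alpha>, E) \<in> S. \<alpha> \<in> biwords r \<and> Poly_Mapping.keys E \<subseteq> biwords r) \<and> single_valued S"

definition irreducible_biword :: "('c::comm_ring_1) red_system \<Rightarrow> biword \<Rightarrow> bool" where
  "irreducible_biword S \<beta> \<longleftrightarrow> \<not> (\<exists>\<beta>\<^sub>1 \<alpha> \<beta>\<^sub>2. \<beta> = \<beta>\<^sub>1 @ \<alpha> @ \<beta>\<^sub>2 \<and> \<alpha> \<in> fst ` S)"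

text \<open>
  \<open>leftmost_red S \<beta> F\<close> is the graph of the recursion defining the leftmost reduction of a biword:
  it holds if that recursion terminates on \<open>\<beta>\<close> with value \<open>F\<close>.
\<close>

inductive leftmost_red ::
  "('c::comm_ring_1) red_system \<Rightarrow> biword \<Rightarrow> 'c formal_sum \<Rightarrow> bool"
  for S :: "'c red_system"
where
  irreducible:
    "irreducible_biword S \<beta> \<Longrightarrow> leftmost_red S \<beta> (\<lambda>\<delta>. if \<delta> = \<beta> then 1 else 0)"
| reducible:
    "\<lbrakk> irreducible_biword S (\<beta>\<^sub>1 @ \<beta>\<^sub>2); (\<beta>\<^sub>2 @ [(x, a)], E) \<in> S;
       \<forall>\<gamma> \<in> Poly_Mapping.keys E. leftmost_red S (\<beta>\<^sub>1 @ \<gamma> @ \<beta>\<^sub>3) (G \<gamma>) \<rbrakk>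
     \<Longrightarrow> leftmost_red S (\<beta>\<^sub>1 @ \<beta>\<^sub>2 @ [(x, a)] @ \<beta>\<^sub>3)
           (\<lambda>\<delta>. \<Sum>\<gamma>\<in>Poly_Mapping.keys E. Poly_Mapping.lookup E \<gamma> * G \<gamma> \<delta>)"

definition reduce_biword :: "('c::comm_ring_1) red_system \<Rightarrow> biword \<Rightarrow> 'c formal_sum" where
  "reduce_biword S \<beta> = (THE F. leftmost_red S \<beta> F)"

text \<open>
  The termwise extension to formal sums. \<open>Sum_any\<close> is the sum over the support of the summand;
  for the two systems below the reduction preserves length, so over a finite alphabet only
  finitely many terms contribute to each coefficient.
\<close>

definition reduce :: "('c::comm_ring_1) red_system \<Rightarrow> 'c formal_sum \<Rightarrow> 'c formal_sum" where
  "reduce S E = (\<lambda>\<delta>. Sum_any (\<lambda>\<beta>. E \<beta> * reduce_biword S \<beta> \<delta>))"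


section \<open>The two systems and the map between them\<close>

definition SF :: "nat \<Rightarrow> laurent_q red_system" where
  "SF r = {([(x, a), (y, b)], Poly_Mapping.single [(y, b), (x, a)] 1) | x y a b.
             x \<in> {1..r} \<and> y \<in> {1..r} \<and> a \<in> {1..r} \<and> b \<in> {1..r} \<and> x > y}"

definition SF_q_coeff :: "nat \<Rightarrow> nat \<Rightarrow> laurent_tq" where
  "SF_q_coeff a b =
     (if a > b then 1 else if a = b then tq_monom 0 1 else tq_monom 0 2)"

definition SF_q :: "nat \<Rightarrow> laurent_tq red_system" where
  "SF_q r = {([(x, a), (y, b)], Poly_Mapping.single [(y, b), (x, a)] (SF_q_coeff a b)) | x y a b.
               x \<in> {1..r} \<and> y \<in> {1..r} \<and> a \<in> {1..r} \<and> b \<in> {1..r} \<and> x > y}"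

definition phi_SF :: "laurent_q formal_sum \<Rightarrow> laurent_tq formal_sum" where
  "phi_SF E = (\<lambda>\<alpha>. laurent_incl (E \<alpha>) * tq_monom (int (exc \<alpha>)) (inv_minus \<alpha>))"


section \<open>Well-definedness of the leftmost reductions\<close>

lemma reduction_system_SF: "reduction_system r (SF r)"
  by (auto simp: reduction_system_def SF_def biwords_def single_valued_def)

lemma reduction_system_SF_q: "reduction_system r (SF_q r)"
  by (auto simp: reduction_system_def SF_q_def biwords_def single_valued_def split: if_splits)

lemma irreducible_biword_prefix:
  "irreducible_biword S (\<beta> @ \<gamma>) \<Longrightarrow> irreducible_biword S \<beta>"
  unfolding irreducible_biword_def by (metis append.assoc)

lemma not_irreducible_biwordI:
  "(\<beta>\<^sub>2 @ [l], E) \<in> S \<Longrightarrow> \<not> irreducible_biword S (\<beta>\<^sub>1 @ \<beta>\<^sub>2 @ [l] @ \<beta>\<^sub>3)"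
  unfolding irreducible_biword_def
  by (simp, rule exI[of _ \<beta>\<^sub>1], rule exI[of _ "\<beta>\<^sub>2 @ [l]"]) force

lemma leftmost_decomp_unique:
  assumes len: "\<And>\<alpha> E. (\<alpha>, E) \<in> S \<Longrightarrow> length \<alpha> = 2"
    and eq: "\<beta>\<^sub>1 @ \<beta>\<^sub>2 @ [l] @ \<beta>\<^sub>3 = \<beta>\<^sub>1' @ \<beta>\<^sub>2' @ [l'] @ \<beta>\<^sub>3'"
    and irr: "irreducible_biword S (\<beta>\<^sub>1 @ \<beta>\<^sub>2)" "irreducible_biword S (\<beta>\<^sub>1' @ \<beta>\<^sub>2')"
    and S: "(\<beta>\<^sub>2 @ [l], E) \<in> S" "(\<beta>\<^sub>2' @ [l'], E') \<in> S"
  shows "\<beta>\<^sub>1 = \<beta>\<^sub>1' \<and> \<beta>\<^sub>2 = \<beta>\<^sub>2' \<and> l = l' \<and> \<beta>\<^sub>3 = \<beta>\<^sub>3'"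
proof -
  have no: False
    if eq: "\<beta>\<^sub>1 @ \<beta>\<^sub>2 @ [l] @ \<beta>\<^sub>3 = \<beta>\<^sub>1' @ \<beta>\<^sub>2' @ [l'] @ \<beta>\<^sub>3'"
      and irr: "irreducible_biword S (\<beta>\<^sub>1' @ \<beta>\<^sub>2')" and S: "(\<beta>\<^sub>2 @ [l], E) \<in> S"
      and lt: "length (\<beta>\<^sub>1 @ \<beta>\<^sub>2) < length (\<beta>\<^sub>1' @ \<beta>\<^sub>2')"
    for \<beta>\<^sub>1 \<beta>\<^sub>2 l \<beta>\<^sub>3 \<beta>\<^sub>1' \<beta>\<^sub>2' l' \<beta>\<^sub>3' E
  proof -
    let ?p = "\<beta>\<^sub>1 @ \<beta>\<^sub>2 @ [l]" and ?p' = "\<beta>\<^sub>1' @ \<beta>\<^sub>2'"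
    have "?p @ \<beta>\<^sub>3 = ?p' @ [l'] @ \<beta>\<^sub>3'"
      using eq by simp
    then have "take (length ?p) (?p @ \<beta>\<^sub>3) = take (length ?p) (?p' @ [l'] @ \<beta>\<^sub>3')"
      by (rule arg_cong)
    moreover have "take (length ?p) (?p @ \<beta>\<^sub>3) = ?p"
      by (metis append_eq_conv_conj)
    moreover have "take (length ?p) (?p' @ [l'] @ \<beta>\<^sub>3') = take (length ?p) ?p'"
      using lt by (subst take_append) simp
    ultimately have "?p' = ?p @ drop (length ?p) ?p'"
      by (metis append_take_drop_id)
    then have "irreducible_biword S (\<beta>\<^sub>1 @ \<beta>\<^sub>2 @ [l])"
      using irr irreducible_biword_prefix by metis
    then show False
      using not_irreducible_biwordI[OF S, of \<beta>\<^sub>1 "[]"] by simp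
  qed
  have l12: "length (\<beta>\<^sub>1 @ \<beta>\<^sub>2) = length (\<beta>\<^sub>1' @ \<beta>\<^sub>2')"
    using no[OF eq irr(2) S(1)] no[OF eq[symmetric] irr(1) S(2)] by (metis nat_neq_iff)
  have "length \<beta>\<^sub>2 = length \<beta>\<^sub>2'"
    using len[OF S(1)] len[OF S(2)] by simp
  moreover from this have "length \<beta>\<^sub>1 = length \<beta>\<^sub>1'"
    using l12 by simp
  ultimately show ?thesis
    using eq by simp
qed

lemma leftmost_red_unique:
  fixes S :: "('c::comm_ring_1) red_system"
  assumes sv: "single_valued S" and len: "\<And>\<alpha> E. (\<alpha>, E) \<in> S \<Longrightarrow> length \<alpha> = 2"
  shows "leftmost_red S \<beta> F \<Longrightarrow> leftmost_red S \<beta> F' \<Longrightarrow> F = F'"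
proof (induction arbitrary: F' rule: leftmost_red.induct)
  case (irreducible \<beta>)
  from irreducible(2,1) show ?case
  proof (cases rule: leftmost_red.cases)
    case (reducible \<beta>\<^sub>1 \<beta>\<^sub>2 x a E \<beta>\<^sub>3 G)
    then show ?thesis
      using irreducible(1) not_irreducible_biwordI by blast
  qed simp
next
  case (reducible \<beta>\<^sub>1 \<beta>\<^sub>2 x a E \<beta>\<^sub>3 G)
  from reducible.prems show ?case
  proof (cases rule: leftmost_red.cases)
    case irreducible
    then show ?thesis
      using not_irreducible_biwordI[OF reducible.hyps(2)] by blast
  next
    case r: (reducible \<beta>\<^sub>1' \<beta>\<^sub>2' x' a' E' \<beta>\<^sub>3' G')
    have *: "\<beta>\<^sub>1 = \<beta>\<^sub>1' \<and> \<beta>\<^sub>2 = \<beta>\<^sub>2' \<and> (x, a) = (x', a') \<and> \<beta>\<^sub>3 = \<beta>\<^sub>3'"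
      by (rule leftmost_decomp_unique[OF _ r(1) reducible.hyps(1) r(3) reducible.hyps(2) r(4)])
        (rule len)
    then have "E = E'"
      using sv reducible.hyps(2) r(4) by (auto dest: single_valuedD)
    then have "G \<gamma> = G' \<gamma>" if "\<gamma> \<in> Poly_Mapping.keys E" for \<gamma>
      using that reducible.IH r(5) * by blast
    then show ?thesis
      unfolding r(2) using \<open>E = E'\<close> by (auto intro!: sum.cong)
  qed
qed

lemma leftmost_decomp_exists:
  assumes "\<not> irreducible_biword S \<beta>" and len: "\<And>\<alpha> E. (\<alpha>, E) \<in> S \<Longrightarrow> length \<alpha> = 2"
  shows "\<exists>\<beta>\<^sub>1 \<beta>\<^sub>2 x a \<beta>\<^sub>3 E. \<beta> = \<beta>\<^sub>1 @ \<beta>\<^sub>2 @ [(x, a)] @ \<beta>\<^sub>3 \<and>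
           irreducible_biword S (\<beta>\<^sub>1 @ \<beta>\<^sub>2) \<and> (\<beta>\<^sub>2 @ [(x, a)], E) \<in> S"
  using assms(1)
proof (induction \<beta> rule: rev_induct)
  case Nil
  then show ?case
    using len by (force simp: irreducible_biword_def)
next
  case (snoc l \<beta>)
  show ?case
  proof (cases "irreducible_biword S \<beta>")
    case False
    then obtain \<beta>\<^sub>1 \<beta>\<^sub>2 x a \<beta>\<^sub>3 E where "\<beta> = \<beta>\<^sub>1 @ \<beta>\<^sub>2 @ [(x, a)] @ \<beta>\<^sub>3"
      "irreducible_biword S (\<beta>\<^sub>1 @ \<beta>\<^sub>2)" "(\<beta>\<^sub>2 @ [(x, a)], E) \<in> S"
      using snoc.IH by blast
    moreover from this(1) have "\<beta> @ [l] = \<beta>\<^sub>1 @ \<beta>\<^sub>2 @ [(x, a)] @ \<beta>\<^sub>3 @ [l]"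
      by simp
    ultimately show ?thesis
      by blast
  next
    case True
    obtain \<beta>\<^sub>1 \<alpha> \<beta>\<^sub>2 E where d: "\<beta> @ [l] = \<beta>\<^sub>1 @ \<alpha> @ \<beta>\<^sub>2" "(\<alpha>, E) \<in> S"
      using snoc.prems unfolding irreducible_biword_def by auto
    have "\<beta>\<^sub>2 = []"
    proof (rule ccontr)
      assume "\<beta>\<^sub>2 \<noteq> []"
      then have "\<beta> = \<beta>\<^sub>1 @ \<alpha> @ butlast \<beta>\<^sub>2"
        using d(1) by (metis append_is_Nil_conv butlast_append butlast_snoc)
      then show False
        using True d(2) unfolding irreducible_biword_def by force
    qed
    have "\<alpha> \<noteq> []"
      using len[OF d(2)] by auto
    then obtain \<alpha>' l' where \<alpha>: "\<alpha> = \<alpha>' @ [l']"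
      by (metis rev_exhaust)
    then have "\<beta> = \<beta>\<^sub>1 @ \<alpha>'" "l = l'"
      using d(1) \<open>\<beta>\<^sub>2 = []\<close> by simp_all
    moreover obtain x a where "l = (x, a)"
      by fastforce
    ultimately have "\<beta> @ [l] = \<beta>\<^sub>1 @ \<alpha>' @ [(x, a)] @ []" "irreducible_biword S (\<beta>\<^sub>1 @ \<alpha>')"
      "(\<alpha>' @ [(x, a)], E) \<in> S"
      using True d(2) \<alpha> by simp_all
    then show ?thesis
      by blast
  qed
qed

primrec top_weight :: "biword \<Rightarrow> nat" where
  "top_weight [] = 0"
| "top_weight (l # \<beta>) = Suc (length \<beta>) * fst l + top_weight \<beta>"

lemma top_weight_swap:
  "y < x \<Longrightarrow> top_weight (\<beta>\<^sub>1 @ (y, b) # (x, a) # \<beta>\<^sub>3) < top_weight (\<beta>\<^sub>1 @ (x, a) # (y, b) # \<beta>\<^sub>3)"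
  by (induction \<beta>\<^sub>1) (auto simp: algebra_simps)

lemma leftmost_red_exists:
  fixes S :: "('c::comm_ring_1) red_system"
  assumes S: "\<And>\<alpha> E. (\<alpha>, E) \<in> S \<Longrightarrow>
      \<exists>x y a b. y < x \<and> \<alpha> = [(x, a), (y, b)] \<and> Poly_Mapping.keys E \<subseteq> {[(y, b), (x, a)]}"
  shows "\<exists>F. leftmost_red S \<beta> F"
proof (induction \<beta> rule: measure_induct_rule[of top_weight])
  case (less \<beta>)
  have len: "length \<alpha> = 2" if "(\<alpha>, E) \<in> S" for \<alpha> E
    using S[OF that] by auto
  show ?case
  proof (cases "irreducible_biword S \<beta>")
    case True
    then show ?thesis
      using leftmost_red.irreducible by blast
  next
    case False
    obtain \<beta>\<^sub>1 \<beta>\<^sub>2 x a \<beta>\<^sub>3 E where d: "\<beta> = \<beta>\<^sub>1 @ \<beta>\<^sub>2 @ [(x, a)] @ \<beta>\<^sub>3"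
      "irreducible_biword S (\<beta>\<^sub>1 @ \<beta>\<^sub>2)" "(\<beta>\<^sub>2 @ [(x, a)], E) \<in> S"
      using leftmost_decomp_exists[OF False] len by blast
    have "\<exists>F. leftmost_red S (\<beta>\<^sub>1 @ \<gamma> @ \<beta>\<^sub>3) F" if "\<gamma> \<in> Poly_Mapping.keys E" for \<gamma>
    proof (rule less.IH)
      obtain x' y' a' b' where s: "y' < x'" "\<beta>\<^sub>2 @ [(x, a)] = [(x', a'), (y', b')]"
          "Poly_Mapping.keys E \<subseteq> {[(y', b'), (x', a')]}"
        using S[OF d(3)] by blast
      have "\<beta> = \<beta>\<^sub>1 @ (\<beta>\<^sub>2 @ [(x, a)]) @ \<beta>\<^sub>3"
        using d(1) by simp
      then have "\<beta> = \<beta>\<^sub>1 @ (x', a') # (y', b') # \<beta>\<^sub>3" "\<gamma> = [(y', b'), (x', a')]"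
        using s that by auto
      then show "top_weight (\<beta>\<^sub>1 @ \<gamma> @ \<beta>\<^sub>3) < top_weight \<beta>"
        using top_weight_swap[OF s(1)] by simp
    qed
    then obtain G where "\<forall>\<gamma> \<in> Poly_Mapping.keys E. leftmost_red S (\<beta>\<^sub>1 @ \<gamma> @ \<beta>\<^sub>3) (G \<gamma>)"
      by metis
    then show ?thesis
      using leftmost_red.reducible[OF d(2,3)] d(1) by blast
  qed
qed

lemma leftmost_red_SF: "\<exists>!F. leftmost_red (SF r) \<beta> F"
proof -
  have "\<exists>F. leftmost_red (SF r) \<beta> F"
    by (rule leftmost_red_exists) (auto simp: SF_def)
  moreover have "single_valued (SF r)"
    using reduction_system_SF by (auto simp: reduction_system_def)
  moreover have "length \<alpha> = 2" if "(\<alpha>, E) \<in> SF r" for \<alpha> E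
    using that by (auto simp: SF_def)
  ultimately show ?thesis
    using leftmost_red_unique[of "SF r"] by blast
qed

lemma leftmost_red_SF_q: "\<exists>!F. leftmost_red (SF_q r) \<beta> F"
proof -
  have "\<exists>F. leftmost_red (SF_q r) \<beta> F"
    by (rule leftmost_red_exists) (auto simp: SF_q_def)
  moreover have "single_valued (SF_q r)"
    using reduction_system_SF_q by (auto simp: reduction_system_def)
  moreover have "length \<alpha> = 2" if "(\<alpha>, E) \<in> SF_q r" for \<alpha> E
    using that by (auto simp: SF_q_def)
  ultimately show ?thesis
    using leftmost_red_unique[of "SF_q r"] by blast
qed

end

theory Submission
  imports Defs
begin

text \<open>
  A single reduction step exchanges two adjacent biletters. It leaves \<open>exc\<close> unchanged, and it
  raises \<open>inv_minus\<close> by exactly the exponent of \<open>q\<close> that \<open>SF_q\<close> attaches to the step. Hence the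
  total \<open>q\<close>-weight picked up along the leftmost reduction of \<open>\<beta>\<close> to its normal form \<open>\<delta>\<close>
  telescopes to \<open>inv_minus \<delta> - inv_minus \<beta>\<close>, which gives (i). For (ii), the inversions between
  the two factors of a concatenation depend only on the contents of the factors, so on circuits
  they cancel between the bottom and the top word.
\<close>

section \<open>The inclusion of Laurent polynomial rings\<close>

lemma lookup_laurent_incl:
  "Poly_Mapping.lookup (laurent_incl p) (i, j) = (if i = 0 then Poly_Mapping.lookup p j else 0)"
proof (cases "i = 0")
  case True
  have "Poly_Mapping.lookup (laurent_incl p) (i, j) =
      (\<Sum>k\<in>Poly_Mapping.keys p. if k = j then Poly_Mapping.lookup p k else 0)"
    using True by (simp add: laurent_incl_def lookup_sum lookup_single when_def)
  then show ?thesis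
    using True by (simp add: in_keys_iff)
qed (simp add: laurent_incl_def lookup_sum lookup_single when_def)

lemma laurent_incl_zero [simp]: "laurent_incl 0 = 0"
  by (simp add: laurent_incl_def)

lemma laurent_incl_add: "laurent_incl (p + p') = laurent_incl p + laurent_incl p'"
  by (rule poly_mapping_eqI) (auto simp: lookup_laurent_incl lookup_add)

lemma laurent_incl_sum: "laurent_incl (sum f A) = (\<Sum>x\<in>A. laurent_incl (f x))"
  using sum_comp_morphism[of laurent_incl f A] by (simp add: laurent_incl_add comp_def)

lemma laurent_incl_single: "laurent_incl (Poly_Mapping.single j c) = Poly_Mapping.single (0, j) c"
  by (cases "c = 0") (simp_all add: laurent_incl_def)

text \<open>Both sides are additive in each factor, so expanding \<open>p\<close> and
  \<open>p'\<close> into monomials reduces the claim to exponents adding as (0, j) + (0,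
  j').\<close>

lemma laurent_incl_mult: "laurent_incl (p * p') = laurent_incl p * laurent_incl p'"
proof -
  have s: "p = (\<Sum>k\<in>Poly_Mapping.keys p. Poly_Mapping.single k (Poly_Mapping.lookup p k))"
    for p :: laurent_q
    by (rule poly_mapping_eqI)
      (simp add: lookup_sum lookup_single when_def in_keys_iff)
  have "laurent_incl (p * p') = laurent_incl
      ((\<Sum>k\<in>Poly_Mapping.keys p. Poly_Mapping.single k (Poly_Mapping.lookup p k)) *
       (\<Sum>k\<in>Poly_Mapping.keys p'. Poly_Mapping.single k (Poly_Mapping.lookup p' k)))"
    using s[of p] s[of p'] by simp
  also have "\<dots> = laurent_incl p * laurent_incl p'"
    by (simp add: sum_product laurent_incl_sum mult_single laurent_incl_single
        laurent_incl_def[of p] laurent_incl_def[of p'])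
  finally show ?thesis .
qed

lemma tq_monom_mult: "tq_monom i j * tq_monom i' j' = tq_monom (i + i') (j + j')"
  by (simp add: tq_monom_def mult_single)

lemma tq_monom_0_0 [simp]: "tq_monom 0 0 = 1"
  by (simp add: tq_monom_def flip: zero_prod_def)

lemma tq_monom_neq_0 [simp]: "tq_monom i j \<noteq> 0"
  by (simp add: tq_monom_def)


section \<open>Inversions and excedances\<close>

lemma inv_word_Nil [simp]: "inv_word [] = 0"
  by (simp add: inv_word_def)

text \<open>Inversions split according to whether the first index is 0. Those at index 0 see only
  the multiset of \<open>w\<close>, so all later arguments can work with contents instead of
  positions.\<close>

lemma inv_word_Cons:
  "inv_word (x # w) = size (filter_mset (\<lambda>y. y < x) (mset w)) + inv_word w"
proof -
  let ?A = "{j. j < length w \<and> w ! j < x}"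
  let ?B = "{(i, j). i < j \<and> j < length w \<and> w ! i > w ! j}"
  have split: "{(i, j). i < j \<and> j < length (x # w) \<and> (x # w) ! i > (x # w) ! j} =
      (\<lambda>j. (0, Suc j)) ` ?A \<union> map_prod Suc Suc ` ?B" (is "?L = ?R")
  proof (rule set_eqI, clarify)
    fix i j
    show "(i, j) \<in> ?L \<longleftrightarrow> (i, j) \<in> ?R"
      \<comment> \<open>Index 0 gives the first image; two successors give a shifted inversion of
        \<open>w\<close>.\<close>
      by (cases i; cases j) (auto simp: image_iff)
  qed
  have "finite ?B"
    by (rule finite_subset[of _ "{..<length w} \<times> {..<length w}"]) auto
  then have "card ?L = card ?A + card ?B"
    unfolding split
    by (subst card_Un_disjoint) (auto simp: card_image inj_on_def)
  moreover have "card ?A = size (filter_mset (\<lambda>y. y < x) (mset w))"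
    by (simp add: length_filter_conv_card flip: mset_filter)
  ultimately show ?thesis
    by (simp add: inv_word_def)
qed

lemma inv_word_append:
  "inv_word (u @ v) = inv_word u + inv_word v +
     (\<Sum>x\<in>#mset u. size (filter_mset (\<lambda>y. y < x) (mset v)))"
  by (induction u) (simp_all add: inv_word_Cons)

text \<open>The cross term of \<open>inv_word_append\<close> depends only on the two multisets. For
  circuits it is the same for the top and the bottom words, so it cancels in the difference.\<close>

lemma inv_minus_append:
  assumes "circuit \<alpha>" "circuit \<beta>"
  shows "inv_minus (\<alpha> @ \<beta>) = inv_minus \<alpha> + inv_minus \<beta>"
  using assms by (simp add: inv_minus_def circuit_def top_word_def bottom_word_def inv_word_append
      del: mset_map)

text \<open>Only the exchanged pair itself can change status: a letter of \<open>u\<close> meets the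
  same multiset to its right before and after.\<close>

lemma inv_word_swap:
  "int (inv_word (u @ b # a # v)) =
     int (inv_word (u @ a # b # v)) + (if a < b then 1 else 0) - (if b < a then 1 else 0)"
  by (induction u) (auto simp: inv_word_Cons)

lemma exc_eq_length_filter: "exc \<alpha> = length (filter (\<lambda>(x, a). x < a) \<alpha>)"
  unfolding exc_def length_filter_conv_card
  by (rule arg_cong[where f = card])
    (auto simp: top_word_def bottom_word_def case_prod_unfold)

lemma exc_append: "exc (\<alpha> @ \<beta>) = exc \<alpha> + exc \<beta>"
  by (simp add: exc_eq_length_filter)

lemma exc_cong_mset: "mset \<alpha> = mset \<beta> \<Longrightarrow> exc \<alpha> = exc \<beta>"
  unfolding exc_eq_length_filter by (metis mset_filter size_mset)

text \<open>The top word loses one inversion, which contributes +1. The bottom word contributes -1,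
  0 or +1 for a > b, a = b, a < b, whence the exponents 0, 1, 2.\<close>

lemma SF_q_coeff_eq_inv_minus:
  assumes "y < x"
  shows "SF_q_coeff a b =
    tq_monom 0 (inv_minus (\<beta> @ [(y, b), (x, a)] @ \<gamma>) - inv_minus (\<beta> @ [(x, a), (y, b)] @ \<gamma>))"
  using assms inv_word_swap[of "map fst \<beta>" y x "map fst \<gamma>"]
    inv_word_swap[of "map snd \<beta>" b a "map snd \<gamma>"]
  by (auto simp: SF_q_coeff_def inv_minus_def top_word_def bottom_word_def)


section \<open>Leftmost reduction\<close>

lemma irreducible_biword_SF_q_iff: "irreducible_biword (SF_q r) \<beta> \<longleftrightarrow> irreducible_biword (SF r) \<beta>"
proof -
  have "fst ` SF_q r = fst ` SF r"
    by (force simp: SF_q_def SF_def image_iff)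
  then show ?thesis
    by (simp add: irreducible_biword_def)
qed

text \<open>Every right-hand side is a multiple of one biword, so the recursion follows a single
  path, and both systems follow the same one. The multiset equation is carried along because it
  later gives equal \<open>exc\<close> and finite sums.\<close>

lemma leftmost_red_SF_imp_SF_q:
  assumes "leftmost_red (SF r) \<beta> F"
  shows "\<exists>\<delta>. mset \<delta> = mset \<beta> \<and> F = (\<lambda>\<epsilon>. if \<epsilon> = \<delta> then 1 else 0) \<and>
           leftmost_red (SF_q r) \<beta>
             (\<lambda>\<epsilon>. if \<epsilon> = \<delta> then tq_monom 0 (inv_minus \<delta> - inv_minus \<beta>) else 0)"
  using assms
proof (induction rule: leftmost_red.induct)
  case (irreducible \<beta>)
  then have "leftmost_red (SF_q r) \<beta> (\<lambda>\<epsilon>. if \<epsilon> = \<beta> then 1 else 0)"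
    by (intro leftmost_red.irreducible) (simp add: irreducible_biword_SF_q_iff)
  then show ?case
    by (intro exI[of _ \<beta>]) (simp cong: if_cong)
next
  case (reducible \<beta>\<^sub>1 \<beta>\<^sub>2 y b E \<beta>\<^sub>3 G)
  from reducible.hyps(2) obtain x a where xa: "\<beta>\<^sub>2 = [(x, a)]" "y < x"
    and E: "E = Poly_Mapping.single [(y, b), (x, a)] 1"
    and mem: "x \<in> {1..r}" "y \<in> {1..r}" "a \<in> {1..r}" "b \<in> {1..r}"
    by (auto simp: SF_def)
  let ?\<gamma> = "[(y, b), (x, a)]"
  let ?\<beta> = "\<beta>\<^sub>1 @ \<beta>\<^sub>2 @ [(y, b)] @ \<beta>\<^sub>3" and ?\<beta>' = "\<beta>\<^sub>1 @ ?\<gamma> @ \<beta>\<^sub>3"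
  have "?\<gamma> \<in> Poly_Mapping.keys E"
    by (simp add: E)
  then obtain \<delta> where \<delta>: "mset \<delta> = mset ?\<beta>'" "G ?\<gamma> = (\<lambda>\<epsilon>. if \<epsilon> = \<delta> then 1 else 0)"
    and red: "leftmost_red (SF_q r) ?\<beta>'
      (\<lambda>\<epsilon>. if \<epsilon> = \<delta> then tq_monom 0 (inv_minus \<delta> - inv_minus ?\<beta>') else 0)"
      (is "leftmost_red _ _ ?H")
    using reducible.IH by blast
  have c: "SF_q_coeff a b = tq_monom 0 (inv_minus ?\<beta>' - inv_minus ?\<beta>)"
    using SF_q_coeff_eq_inv_minus[OF xa(2), of a b \<beta>\<^sub>1 \<beta>\<^sub>3] by (simp add: xa(1))
  let ?E = "Poly_Mapping.single ?\<gamma> (SF_q_coeff a b)"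
  have "irreducible_biword (SF_q r) (\<beta>\<^sub>1 @ \<beta>\<^sub>2)"
    using reducible.hyps(1) by (simp add: irreducible_biword_SF_q_iff)
  moreover have "(\<beta>\<^sub>2 @ [(y, b)], ?E) \<in> SF_q r"
    using xa mem by (auto simp: SF_q_def)
  moreover have "\<forall>\<gamma>\<in>Poly_Mapping.keys ?E. leftmost_red (SF_q r) (\<beta>\<^sub>1 @ \<gamma> @ \<beta>\<^sub>3) ?H"
    using red by simp
  ultimately have "leftmost_red (SF_q r) ?\<beta>
      (\<lambda>\<epsilon>. \<Sum>\<gamma>\<in>Poly_Mapping.keys ?E. Poly_Mapping.lookup ?E \<gamma> * ?H \<epsilon>)"
    by (rule leftmost_red.reducible[where G = "\<lambda>_. ?H"])
  \<comment> \<open>The sum has one term, and in the product of the two monomials the exponent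
    \<open>inv_minus ?\<beta>'\<close> cancels.\<close>
  also have "(\<lambda>\<epsilon>. \<Sum>\<gamma>\<in>Poly_Mapping.keys ?E. Poly_Mapping.lookup ?E \<gamma> * ?H \<epsilon>) =
      (\<lambda>\<epsilon>. if \<epsilon> = \<delta> then tq_monom 0 (inv_minus \<delta> - inv_minus ?\<beta>) else 0)"
    by (simp add: c tq_monom_mult fun_eq_iff del: append_Cons append.simps)
  finally show ?case
    using \<delta> by (intro exI[of _ \<delta>]) (simp add: xa E)
qed

lemma reduce_biword_SF:
  obtains \<delta> where "mset \<delta> = mset \<beta>"
    and "reduce_biword (SF r) \<beta> = (\<lambda>\<epsilon>. if \<epsilon> = \<delta> then 1 else 0)"
    and "reduce_biword (SF_q r) \<beta> =
      (\<lambda>\<epsilon>. if \<epsilon> = \<delta> then tq_monom 0 (inv_minus \<delta> - inv_minus \<beta>) else 0)"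
proof -
  have red: "leftmost_red (SF r) \<beta> (reduce_biword (SF r) \<beta>)"
    unfolding reduce_biword_def by (rule theI'[OF leftmost_red_SF])
  obtain \<delta> where \<delta>: "mset \<delta> = mset \<beta>"
      "reduce_biword (SF r) \<beta> = (\<lambda>\<epsilon>. if \<epsilon> = \<delta> then 1 else 0)"
      "leftmost_red (SF_q r) \<beta>
         (\<lambda>\<epsilon>. if \<epsilon> = \<delta> then tq_monom 0 (inv_minus \<delta> - inv_minus \<beta>) else 0)"
    using leftmost_red_SF_imp_SF_q[OF red] by blast
  show thesis
    using that[OF \<delta>(1,2)] the1_equality[of "leftmost_red (SF_q r) \<beta>", OF leftmost_red_SF_q \<delta>(3)]
    by (simp add: reduce_biword_def)
qed

text \<open>Only rearrangements of \<delta> can reduce to \<delta>, and these are finitely many. The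
  resulting index set is the same for both systems, so (i) can be compared term by term.\<close>

lemma reduce_eq_sum_mset_eq:
  assumes "\<And>\<beta> \<delta>. reduce_biword S \<beta> \<delta> \<noteq> 0 \<Longrightarrow> mset \<beta> = mset \<delta>"
  shows "reduce S E \<delta> = (\<Sum>\<beta> | mset \<beta> = mset \<delta>. E \<beta> * reduce_biword S \<beta> \<delta>)"
  unfolding reduce_def
  by (rule Sum_any.expand_superset[OF mset_eq_finite]) (use assms in force)

lemma phi_SF_reduce: "phi_SF (reduce (SF r) E) = reduce (SF_q r) (phi_SF E)"
proof
  fix \<delta>
  have supp: "mset \<beta> = mset \<delta>" if "reduce_biword (SF r) \<beta> \<delta> \<noteq> 0" for \<beta> \<delta>
    by (rule reduce_biword_SF[of \<beta> r]) (use that in \<open>auto split: if_splits\<close>)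
  have supp_q: "mset \<beta> = mset \<delta>" if "reduce_biword (SF_q r) \<beta> \<delta> \<noteq> 0" for \<beta> \<delta>
    by (rule reduce_biword_SF[of \<beta> r]) (use that in \<open>auto split: if_splits\<close>)
  \<comment> \<open>If \<beta> reduces to \<delta>, the weight of \<beta> times q to the power
    \<open>inv_minus \<delta> - inv_minus \<beta>\<close> is the weight of \<delta>; otherwise both
    sides vanish.\<close>
  have "laurent_incl (E \<beta> * reduce_biword (SF r) \<beta> \<delta>) * tq_monom (int (exc \<delta>)) (inv_minus \<delta>) =
      phi_SF E \<beta> * reduce_biword (SF_q r) \<beta> \<delta>" for \<beta>
    by (rule reduce_biword_SF[of \<beta> r])
      (auto simp: phi_SF_def mult.assoc tq_monom_mult dest: exc_cong_mset)
  then show "phi_SF (reduce (SF r) E) \<delta> = reduce (SF_q r) (phi_SF E) \<delta>"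
    by (simp add: phi_SF_def[of "reduce (SF r) E"] reduce_eq_sum_mset_eq[of "SF r", OF supp]
        reduce_eq_sum_mset_eq[of "SF_q r", OF supp_q] laurent_incl_sum sum_distrib_right)
qed

lemma phi_SF_fs_mult:
  assumes "circular E" "circular F"
  shows "phi_SF (fs_mult E F) = fs_mult (phi_SF E) (phi_SF F)"
proof
  fix \<alpha>
  have "laurent_incl (E \<beta> * F \<gamma>) * tq_monom (int (exc \<alpha>)) (inv_minus \<alpha>) = phi_SF E \<beta> * phi_SF F \<gamma>"
    if "\<beta> @ \<gamma> = \<alpha>" for \<beta> \<gamma>
  \<comment> \<open>A nonzero term forces both factors to be circuits, where the weight is
    multiplicative; all other terms are 0 on both sides.\<close>
  proof (cases "E \<beta> = 0 \<or> F \<gamma> = 0")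
    case False
    then have "circuit \<beta>" "circuit \<gamma>"
      using assms by (auto simp: circular_def)
    then have "tq_monom (int (exc \<alpha>)) (inv_minus \<alpha>) =
        tq_monom (int (exc \<beta>)) (inv_minus \<beta>) * tq_monom (int (exc \<gamma>)) (inv_minus \<gamma>)"
      by (simp add: tq_monom_mult exc_append inv_minus_append flip: that)
    then show ?thesis
      by (simp add: phi_SF_def laurent_incl_mult mult_ac)
  qed (auto simp: phi_SF_def)
  then show "phi_SF (fs_mult E F) \<alpha> = fs_mult (phi_SF E) (phi_SF F) \<alpha>"
    unfolding phi_SF_def[of "fs_mult E F"]
    unfolding fs_mult_def laurent_incl_sum sum_distrib_right
    by (intro sum.cong) auto
qed

theorem mainTheorem3:
  fixes r :: nat
  assumes "r \<ge> 1"
  shows "(\<forall>E \<in> formal_sums r. phi_SF (reduce (SF r) E) = reduce (SF_q r) (phi_SF E)) \<and>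
         (\<forall>E \<in> formal_sums r. \<forall>F \<in> formal_sums r. circular E \<longrightarrow> circular F \<longrightarrow>
            phi_SF (fs_mult E F) = fs_mult (phi_SF E) (phi_SF F))"
  by (simp add: phi_SF_reduce phi_SF_fs_mult)

end
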